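(* Let $f:\mathbb{R}^d\to(-\infty,\infty]$ be a proper closed convex function, let $\mathcal{X}\subseteq\mathbb{R}^d$ be a non-empty closed convex set, let $f^\star=\inf_{x\in\mathcal{X}}f(x)$, let $h:\mathbb{R}^d\to(-\infty,\infty]$ be convex, let $\|\cdot\|$ be a norm on $\mathbb{R}^d$ with dual norm $\|\cdot\|_*$, and for each $x\in\mathcal{X}\cap\operatorname{int}\operatorname{dom}h$ let $g(x)$ be a (fixed choice of) subgradient of $f$ at $x$. Assume: 1. $f^\star$ is finite. 2. $h$ is Legendre and $\mathcal{X}\cap\operatorname{dom}f$ is contained in the closure of $\operatorname{dom}h$. 3. The relative interior of $\operatorname{dom}f$ contains $\mathcal{X}\cap\operatorname{int}\operatorname{dom}h$. 4. $D_h(x,y)\ge\frac12\|y-x\|^2$ for all $x,y\in\mathcal{X}\cap\operatorname{int}\operatorname{dom}h$. 5. The mapping $g(\cdot)$ is bounded on every compact subset of $\mathcal{X}\cap\operatorname{int}\operatorname{dom}h$. Let $\delta_1\ge\delta>0$, $\beta<1$, $\gamma\ge1$, $c>1/2$, and $x_1\in\mathcal{X}\cap\operatorname{int}\operatorname{dom}h$. Generate iterates by the following algorithm: for $k=1,2,3,\dots$, (i) if $g(x_k)=0$, return $x_k$ as a minimizer and terminate; (ii) set $\hat f_k=\min_{1\le\kappa\le k}f(x_\kappa)-\delta_k$; (iii) set $\eta_k=\dfrac{f(x_k)-\hat f_k}{c\,\|g(x_k)\|_*^2}$; (iv) set $x_{k+1}=T(x_k;\eta_k)$; (v) if $f(x_{k+1})\le\hat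 f_k$, set $\delta_{k+1}=\gamma\delta_k$; otherwise set $\delta_{k+1}=\max\{\beta\delta_k,\delta\}$. Then $$\inf_{k}f(x_k)\le f^\star+\delta,$$ where the infimum is over all generated iterates (all $k\in\mathbb{N}$ if the algorithm never terminates).
   Context: The Bregman divergence associated with $h$ is $D_h(x,y)=h(x)-h(y)-\langle\nabla h(y),x-y\rangle$ for $(x,y)\in\operatorname{dom}h\times\operatorname{dom}\nabla h$. For $x\in\mathcal{X}\cap\operatorname{int}\operatorname{dom}h$ and a step size $\eta>0$, $T(x;\eta)$ denotes a solution of the minimization problem $$\min_{y\in\mathcal{X}}\ \langle g(x),y-x\rangle+\frac{D_h(y,x)}{\eta}$$ (the mirror descent step). A function $h$ is Legendre if it is proper, closed, convex, essentially smooth (its domain has non-empty interior, it is differentiable on $\operatorname{int}\operatorname{dom}h$, and $\|\nabla h(x_n)\|\to\infty$ whenever $(x_n)\subset\operatorname{int}\operatorname{dom}h$ converges to a boundary point of $\operatorname{dom}h$) and essentially strictly convex (strictly convex on every convex subset of the domain of its subdifferential). In particular $\operatorname{dom}\nabla h=\operatorname{int}\operatorname{dom}h$. *)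

theory Defs
  imports "HOL-Analysis.Analysis"
begin

text \<open>
  Functions into the interval from minus infinity (excluded) to plus infinity are represented by
  extended-real valued functions; \<open>proper\<close> excludes the value minus infinity.
\<close>

definition edom :: "('a \<Rightarrow> ereal) \<Rightarrow> 'a set" where
  "edom f = {x. f x < \<infinity>}"

definition eepigraph :: "('a \<Rightarrow> ereal) \<Rightarrow> ('a \<times> real) set" where
  "eepigraph f = {(x, r). f x \<le> ereal r}"

definition proper :: "('a \<Rightarrow> ereal) \<Rightarrow> bool" where
  "proper f \<longleftrightarrow> (\<forall>x. f x \<noteq> -\<infinity>) \<and> (\<exists>x. f x < \<infinity>)"

definition closed_fun :: "('a::topological_space \<Rightarrow> ereal) \<Rightarrow> bool" where
  "closed_fun f \<longleftrightarrow> closed (eepigraph f)"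

definition convex_fun :: "('a::real_vector \<Rightarrow> ereal) \<Rightarrow> bool" where
  "convex_fun f \<longleftrightarrow> convex (eepigraph f)"

definition subdifferential :: "('a::real_inner \<Rightarrow> ereal) \<Rightarrow> 'a \<Rightarrow> 'a set" where
  "subdifferential f x = {v. \<forall>y. f x + ereal (v \<bullet> (y - x)) \<le> f y}"

text \<open>
  The gradient is that of the real-valued part. It is only meaningful on the interior of the
  effective domain: outside the domain \<open>real_of_ereal\<close> turns infinity into 0.
\<close>

definition gradient :: "('a::real_inner \<Rightarrow> ereal) \<Rightarrow> 'a \<Rightarrow> 'a" where
  "gradient h x = (THE v. GDERIV (\<lambda>z. real_of_ereal (h z)) x :> v)"

definition essentially_smooth :: "('a::euclidean_space \<Rightarrow> ereal) \<Rightarrow> bool" where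
  "essentially_smooth h \<longleftrightarrow>
     interior (edom h) \<noteq> {} \<and>
     (\<forall>x \<in> interior (edom h). (\<lambda>z. real_of_ereal (h z)) differentiable (at x)) \<and>
     (\<forall>z x. (\<forall>n. z n \<in> interior (edom h)) \<and> x \<in> frontier (edom h) \<and> z \<longlonglongrightarrow> x \<longrightarrow>
        filterlim (\<lambda>n::nat. norm (gradient h (z n))) at_top sequentially)"

definition strictly_convex_fun_on :: "'a::real_vector set \<Rightarrow> ('a \<Rightarrow> ereal) \<Rightarrow> bool" where
  "strictly_convex_fun_on C h \<longleftrightarrow>
     (\<forall>x \<in> C. \<forall>y \<in> C. \<forall>t. x \<noteq> y \<and> 0 < t \<and> t < 1 \<longrightarrow>
        h ((1 - t) *\<^sub>R x + t *\<^sub>R y) < ereal (1 - t) * h x + ereal t * h y)"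

definition essentially_strictly_convex :: "('a::real_inner \<Rightarrow> ereal) \<Rightarrow> bool" where
  "essentially_strictly_convex h \<longleftrightarrow>
     (\<forall>C. convex C \<and> C \<subseteq> {x. subdifferential h x \<noteq> {}} \<longrightarrow> strictly_convex_fun_on C h)"

definition Legendre_fun :: "('a::euclidean_space \<Rightarrow> ereal) \<Rightarrow> bool" where
  "Legendre_fun h \<longleftrightarrow>
     proper h \<and> closed_fun h \<and> convex_fun h \<and> essentially_smooth h \<and> essentially_strictly_convex h"

text \<open>
  The first argument ranges over the whole space, the divergence being infinite outside the
  effective domain of \<open>h\<close>; the second one is meant to lie in the interior of that domain.
\<close>

definition Bregman :: "('a::real_inner \<Rightarrow> ereal) \<Rightarrow> 'a \<Rightarrow> 'a \<Rightarrow> ereal" where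
  "Bregman h x y = h x - h y - ereal (gradient h y \<bullet> (x - y))"

definition is_norm :: "('a::real_vector \<Rightarrow> real) \<Rightarrow> bool" where
  "is_norm N \<longleftrightarrow>
     (\<forall>x. 0 \<le> N x) \<and> (\<forall>x. N x = 0 \<longleftrightarrow> x = 0) \<and>
     (\<forall>a x. N (a *\<^sub>R x) = \<bar>a\<bar> * N x) \<and> (\<forall>x y. N (x + y) \<le> N x + N y)"

definition dual_norm :: "('a::real_inner \<Rightarrow> real) \<Rightarrow> 'a \<Rightarrow> real" where
  "dual_norm N z = Sup {z \<bullet> x | x. N x \<le> 1}"

text \<open>\<open>v\<close> is the chosen subgradient at the current point \<open>x\<close>, and \<open>y\<close> a mirror descent step.\<close>

definition mirror_step ::
    "('a::real_inner \<Rightarrow> ereal) \<Rightarrow> 'a set \<Rightarrow> 'a \<Rightarrow> 'a \<Rightarrow> real \<Rightarrow> 'a \<Rightarrow> bool" where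
  "mirror_step h X v x \<eta> y \<longleftrightarrow>
     is_arg_min (\<lambda>z. ereal (v \<bullet> (z - x)) + Bregman h z x / ereal \<eta>) (\<lambda>z. z \<in> X) y"

text \<open>
  Indices (from 1) of the iterates generated before termination: the run stops after the
  first \<open>x k\<close> with \<open>g (x k) = 0\<close>, which is itself generated.
\<close>

definition generated :: "('a \<Rightarrow> 'a::zero) \<Rightarrow> (nat \<Rightarrow> 'a) \<Rightarrow> nat set" where
  "generated g x = {k. 1 \<le> k \<and> (\<forall>j. 1 \<le> j \<and> j < k \<longrightarrow> g (x j) \<noteq> 0)}"

end

theory Submission
  imports Defs
begin

text \<open>
  Suppose all values \<open>f (x k)\<close> stay above some \<open>r > fstar + \<delta>\<close>. A step that meets its target lowers
  the best value by at least \<open>\<delta>\<close>, so this happens finitely often and the gap \<open>\<Delta> k\<close> is eventually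
  \<open>\<delta>\<close>; from then on the targets are at least \<open>r - \<delta> > fstar\<close>. Choose \<open>w\<close> in \<open>X\<close> and in the
  interior of \<open>edom h\<close> with \<open>f w = r - \<delta> - \<epsilon>\<close>, where \<open>\<epsilon> > 0\<close>. The three-point inequality for the
  mirror step then gives \<open>D(w, x (k + 1)) \<le> D(w, x k) - \<eta> k * \<epsilon>\<close>. Hence \<open>D(w, x k)\<close> is bounded, which
  confines the iterates to a compact subset of the interior of \<open>edom h\<close>: strong convexity bounds
  them, and a bounded divergence bounds the gradients of \<open>h\<close>, so essential smoothness keeps them off
  the boundary. The subgradients are therefore bounded and the \<open>\<eta> k\<close> bounded away from zero, so
  \<open>D(w, x k)\<close> becomes negative, a contradiction.
\<close>

section \<open>Extended-real convex functions and one-sided derivatives\<close>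

lemma edom_ereal:
  assumes "proper f" "z \<in> edom f"
  shows "f z = ereal (real_of_ereal (f z))"
  using assms by (auto simp: proper_def edom_def intro!: ereal_real'[symmetric])

lemma convex_fun_ineq:
  assumes "proper f" "convex_fun f" "y \<in> edom f" "z \<in> edom f" "0 \<le> t" "t \<le> 1"
  shows "(1 - t) *\<^sub>R y + t *\<^sub>R z \<in> edom f"
    and "real_of_ereal (f ((1 - t) *\<^sub>R y + t *\<^sub>R z))
           \<le> (1 - t) * real_of_ereal (f y) + t * real_of_ereal (f z)"
proof -
  define p where "p = (1 - t) *\<^sub>R y + t *\<^sub>R z"
  define r where "r = (1 - t) * real_of_ereal (f y) + t * real_of_ereal (f z)"
  have "(y, real_of_ereal (f y)) \<in> eepigraph f" "(z, real_of_ereal (f z)) \<in> eepigraph f"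
    using edom_ereal[OF assms(1)] assms(3,4) by (auto simp: eepigraph_def)
  then have "(1 - t) *\<^sub>R (y, real_of_ereal (f y)) + t *\<^sub>R (z, real_of_ereal (f z)) \<in> eepigraph f"
    using assms(2,5,6) unfolding convex_fun_def by (intro convexD) auto
  then have le: "f p \<le> ereal r"
    by (simp add: eepigraph_def p_def r_def)
  then show dom: "p \<in> edom f" by (auto simp: edom_def intro: le_less_trans)
  show "real_of_ereal (f p) \<le> r" using le edom_ereal[OF assms(1) dom] by (metis ereal_less_eq(3))
qed

lemma convex_edom: "proper f \<Longrightarrow> convex_fun f \<Longrightarrow> convex (edom f)"
  unfolding convex_alt by (simp add: convex_fun_ineq(1))

text \<open>A one-sided limit is enough, because the convexity and minimality inequalities below
  compare values along a segment only for small t > 0.\<close>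

lemma directional_derivative:
  fixes f :: "'a::real_inner \<Rightarrow> real"
  assumes "GDERIV f y :> v"
  shows "((\<lambda>t. (f (y + t *\<^sub>R d) - f y) / t) \<longlongrightarrow> v \<bullet> d) (at_right 0)"
proof -
  have "(f has_derivative (\<lambda>u. u \<bullet> v)) (at (y + 0 *\<^sub>R d))"
    using assms by (simp add: gderiv_def)
  moreover have "((\<lambda>t. y + t *\<^sub>R d) has_derivative (\<lambda>t. t *\<^sub>R d)) (at 0)"
    by (auto intro!: derivative_eq_intros)
  ultimately have "((\<lambda>t. f (y + t *\<^sub>R d)) has_derivative (\<lambda>t. (t *\<^sub>R d) \<bullet> v)) (at 0)"
    by (rule has_derivative_compose[rotated])
  then have "((\<lambda>t. f (y + t *\<^sub>R d)) has_real_derivative (v \<bullet> d)) (at 0)"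
    by (simp add: has_field_derivative_def inner_commute mult.commute[of _ "_ \<bullet> _"])
  then have "((\<lambda>t. (f (y + t *\<^sub>R d) - f y) / t) \<longlongrightarrow> v \<bullet> d) (at 0)"
    by (simp add: DERIV_def)
  then show ?thesis
    by (rule tendsto_within_subset) simp
qed

section \<open>The real-valued divergence and the mirror step\<close>

text \<open>A real counterpart of \<open>Bregman\<close> that permits ordinary arithmetic. Its
  values of \<open>h\<close> are meaningful only when both points lie in \<open>edom h\<close>,
  since \<open>real_of_ereal\<close> sends infinity to 0.\<close>

definition bregman :: "('a::real_inner \<Rightarrow> ereal) \<Rightarrow> 'a \<Rightarrow> 'a \<Rightarrow> real" where
  "bregman h x y = real_of_ereal (h x) - real_of_ereal (h y) - gradient h y \<bullet> (x - y)"

lemma Bregman_eq: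
  assumes "proper h" "x \<in> edom h" "y \<in> edom h"
  shows "Bregman h x y = ereal (bregman h x y)"
  using edom_ereal[OF assms(1,2)] edom_ereal[OF assms(1,3)]
  unfolding Bregman_def bregman_def by (metis ereal_minus(1))

text \<open>Outside \<open>edom h\<close> the objective is infinite and cannot be minimal, because
  \<open>x\<close> itself competes with a finite value. On \<open>edom h\<close> it is real and may
  be multiplied by \<eta>.\<close>

lemma mirror_step_iff:
  assumes "proper h" "x \<in> X" "x \<in> edom h" "\<eta> > 0"
  shows "mirror_step h X v x \<eta> y \<longleftrightarrow> y \<in> X \<inter> edom h \<and>
    (\<forall>z \<in> X \<inter> edom h. \<eta> * (v \<bullet> (y - x)) + bregman h y x \<le> \<eta> * (v \<bullet> (z - x)) + bregman h z x)"
proof -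
  define \<Phi> where "\<Phi> z = ereal (v \<bullet> (z - x)) + Bregman h z x / ereal \<eta>" for z
  have out: "\<Phi> z = \<infinity>" if "z \<notin> edom h" for z
  proof -
    have "h z = \<infinity>" using that by (auto simp: edom_def)
    then have "Bregman h z x = \<infinity>"
      using edom_ereal[OF assms(1,3)] by (cases "h x") (auto simp: Bregman_def)
    then show ?thesis using assms(4) by (simp add: \<Phi>_def)
  qed
  have ins: "\<Phi> z = ereal (v \<bullet> (z - x) + bregman h z x / \<eta>)" if "z \<in> edom h" for z
    using Bregman_eq[OF assms(1) that assms(3)] assms(4) by (simp add: \<Phi>_def)
  have le: "\<Phi> y \<le> \<Phi> z \<longleftrightarrow> \<eta> * (v \<bullet> (y - x)) + bregman h y x \<le> \<eta> * (v \<bullet> (z - x)) + bregman h z x"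
    if "y \<in> edom h" "z \<in> edom h" for y z
  proof -
    have "\<eta> * (v \<bullet> (u - x) + bregman h u x / \<eta>) = \<eta> * (v \<bullet> (u - x)) + bregman h u x" for u
      using assms(4) by (simp add: field_simps)
    then show ?thesis
      using ins[OF that(1)] ins[OF that(2)] mult_le_cancel_left_pos[OF assms(4)]
      by (metis ereal_less_eq(3))
  qed
  have "mirror_step h X v x \<eta> y \<longleftrightarrow> y \<in> X \<and> (\<forall>z\<in>X. \<Phi> y \<le> \<Phi> z)"
    unfolding mirror_step_def is_arg_min_def \<Phi>_def by (auto simp: not_less)
  also have "\<dots> \<longleftrightarrow> y \<in> X \<inter> edom h \<and> (\<forall>z\<in>X \<inter> edom h. \<Phi> y \<le> \<Phi> z)"
  proof -
    have "y \<in> edom h" if "\<forall>z\<in>X. \<Phi> y \<le> \<Phi> z"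
      using that assms(2) out[of y] ins[OF assms(3)] by force
    moreover have "\<Phi> y \<le> \<Phi> z" if "z \<notin> edom h" for z using out[OF that] by simp
    ultimately show ?thesis by blast
  qed
  finally show ?thesis using le by blast
qed

section \<open>Legendre functions: gradients, and minimizers of linear perturbations\<close>

context
  fixes h :: "'a::euclidean_space \<Rightarrow> ereal"
  assumes legendre: "Legendre_fun h"
begin

lemma legendre_proper: "proper h"
  and legendre_closed: "closed (eepigraph h)"
  and legendre_convex: "convex_fun h"
  and legendre_convex_edom: "convex (edom h)"
  using legendre convex_edom by (auto simp: Legendre_fun_def closed_fun_def)

text \<open>The adjoint of the derivative, applied to 1, is its Riesz vector. Uniqueness of this
  vector justifies the description operator in \<open>gradient\<close>.\<close>

lemma gradient_GDERIV:
  assumes "y \<in> interior (edom h)"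
  shows "GDERIV (\<lambda>z. real_of_ereal (h z)) y :> gradient h y"
proof -
  obtain A where A: "((\<lambda>z. real_of_ereal (h z)) has_derivative A) (at y)"
    using legendre assms unfolding Legendre_fun_def essentially_smooth_def differentiable_def by blast
  then have lin: "linear A" by (rule has_derivative_linear)
  define G where "G = adjoint A 1"
  have "A = (\<lambda>u. u \<bullet> G)"
    using adjoint_works[OF lin, of _ 1] by (simp add: G_def fun_eq_iff)
  then have deriv: "GDERIV (\<lambda>z. real_of_ereal (h z)) y :> G"
    using A by (simp add: gderiv_def)
  have "v = G" if "GDERIV (\<lambda>z. real_of_ereal (h z)) y :> v" for v
  proof -
    have "(\<lambda>u. u \<bullet> v) = (\<lambda>u. u \<bullet> G)"
      using that deriv unfolding gderiv_def by (rule has_derivative_unique)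
    from fun_cong[OF this, of "v - G"] have "(v - G) \<bullet> (v - G) = 0"
      by (simp add: inner_diff_right)
    then show ?thesis by simp
  qed
  then have "gradient h y = G"
    unfolding gradient_def using deriv by (intro the_equality)
  then show ?thesis using deriv by simp
qed

text \<open>Convexity bounds the difference quotients from \<open>y\<close> towards \<open>z\<close>
  by the increment of \<open>h\<close>; the limit is the gradient inequality. Here \<open>z\<close>
  may be a boundary point of the domain.\<close>

lemma bregman_nonneg:
  assumes y: "y \<in> interior (edom h)" and z: "z \<in> edom h"
  shows "bregman h z y \<ge> 0"
proof -
  let ?H = "\<lambda>z. real_of_ereal (h z)"
  have "eventually (\<lambda>t::real. t \<in> {0<..<1}) (at_right 0)"
    using eventually_at_right_real[of 0 1] by simp
  then have "eventually (\<lambda>t. (?H (y + t *\<^sub>R (z - y)) - ?H y) / t \<le> ?H z - ?H y) (at_right 0)"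
  proof eventually_elim
    case (elim t)
    have "?H ((1 - t) *\<^sub>R y + t *\<^sub>R z) \<le> (1 - t) * ?H y + t * ?H z"
      using y z interior_subset elim
      by (intro convex_fun_ineq(2) legendre_proper legendre_convex) auto
    moreover have "y + t *\<^sub>R (z - y) = (1 - t) *\<^sub>R y + t *\<^sub>R z" by (simp add: algebra_simps)
    ultimately show ?case using elim by (simp add: field_simps)
  qed
  then have "gradient h y \<bullet> (z - y) \<le> ?H z - ?H y"
    by (intro tendsto_upperbound[OF directional_derivative[OF gradient_GDERIV[OF y]]]) auto
  then show ?thesis by (simp add: bregman_def)
qed

text \<open>
  The gradient inequality at \<open>y\<close>, tested on a ball around \<open>w\<close> where \<open>h\<close> is bounded above:
  bounded divergence from \<open>w\<close> means bounded gradients.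
\<close>

lemma gradient_le_bregman:
  assumes w: "w \<in> interior (edom h)"
  obtains e B where "e > 0"
    "\<And>y. y \<in> interior (edom h) \<Longrightarrow> e * norm (gradient h y) \<le> B + bregman h w y"
proof -
  let ?H = "\<lambda>z. real_of_ereal (h z)"
  obtain e where e: "e > 0" "cball w e \<subseteq> interior (edom h)"
    using w open_contains_cball open_interior by blast
  have "?H differentiable (at z)" if "z \<in> interior (edom h)" for z
    using gradient_GDERIV[OF that] unfolding gderiv_def differentiable_def by blast
  then have "continuous_on (cball w e) ?H"
    using e by (intro continuous_at_imp_continuous_on ballI differentiable_imp_continuous_within) auto
  then obtain z0 where z0: "\<And>z. z \<in> cball w e \<Longrightarrow> ?H z \<le> ?H z0"
    using continuous_attains_sup[of "cball w e" ?H] e by (auto simp del: mem_cball)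
  show ?thesis
  proof (rule that)
    fix y assume y: "y \<in> interior (edom h)"
    \<comment> \<open>The point of the ball furthest along the gradient, where the linear term gains
      \<open>e * norm (gradient h y)\<close>. A zero gradient is covered by
      \<open>sgn 0 = 0\<close>.\<close>
    define u where "u = w + e *\<^sub>R sgn (gradient h y)"
    have u: "u \<in> cball w e" using e by (simp add: u_def dist_norm norm_sgn)
    have "0 \<le> bregman h u y"
      using bregman_nonneg[OF y] u e interior_subset by blast
    moreover have "gradient h y \<bullet> sgn (gradient h y) = norm (gradient h y)"
      by (cases "gradient h y = 0") (simp_all add: sgn_div_norm dot_square_norm power2_eq_square)
    then have "gradient h y \<bullet> (u - y) = e * norm (gradient h y) + gradient h y \<bullet> (w - y)"
      by (simp add: u_def inner_diff_right inner_add_right)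
    ultimately show "e * norm (gradient h y) \<le> (?H z0 - ?H w) + bregman h w y"
      using z0[OF u] by (simp add: bregman_def)
  qed (rule e)
qed

text \<open>Essential smoothness in contrapositive form: a limit of interior points that is not
  interior lies on the boundary, and there the gradients would blow up.\<close>

lemma limit_in_interior:
  assumes z: "\<And>n. z n \<in> interior (edom h)" "z \<longlonglongrightarrow> y"
    and bd: "\<And>n. norm (gradient h (z n)) \<le> B"
  shows "y \<in> interior (edom h)"
proof (rule ccontr)
  assume "y \<notin> interior (edom h)"
  moreover have "y \<in> closure (edom h)"
    unfolding closure_sequential using z interior_subset by blast
  ultimately have "y \<in> frontier (edom h)" by (simp add: frontier_def)
  then have "filterlim (\<lambda>n. norm (gradient h (z n))) at_top sequentially"
    using legendre z unfolding Legendre_fun_def essentially_smooth_def by blast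
  then have "eventually (\<lambda>n. B < norm (gradient h (z n))) sequentially"
    by (simp add: filterlim_at_top_dense)
  then obtain n where "B < norm (gradient h (z n))"
    by (auto simp: eventually_sequentially)
  then show False using bd[of n] by simp
qed

text \<open>The points \<open>z n\<close> tend to \<open>y\<close> along the segment from the
  interior point \<open>x\<close>. Minimality of \<open>y\<close> bounds the slope of
  \<open>h\<close> at \<open>z n\<close> in direction \<open>x - y\<close> from below. This bounds
  \<open>bregman h x (z n)\<close> and, by \<open>gradient_le_bregman\<close>, the gradients, so
  \<open>y\<close> is not a boundary point.\<close>

lemma minimizer_in_interior:
  assumes X: "convex X" and x: "x \<in> X \<inter> interior (edom h)" and y: "y \<in> X \<inter> edom h"
    and min: "\<And>z. z \<in> X \<inter> edom h \<Longrightarrow>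
      a \<bullet> (y - x) + real_of_ereal (h y) \<le> a \<bullet> (z - x) + real_of_ereal (h z)"
  shows "y \<in> interior (edom h)"
proof -
  let ?H = "\<lambda>z. real_of_ereal (h z)"
  obtain e B where e: "e > 0"
    "\<And>y. y \<in> interior (edom h) \<Longrightarrow> e * norm (gradient h y) \<le> B + bregman h x y"
    using gradient_le_bregman x by blast
  define t where "t n = inverse (real (Suc (Suc n)))" for n
  define z where "z n = (1 - t n) *\<^sub>R y + t n *\<^sub>R x" for n
  have t: "0 < t n" "t n \<le> 1" for n by (auto simp: t_def field_simps)
  have zy: "z n = y - t n *\<^sub>R (y - x)" for n by (simp add: z_def algebra_simps)
  have zi: "z n \<in> interior (edom h)" for n
    unfolding zy using x y t by (intro mem_interior_convex_shrink legendre_convex_edom) auto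
  have zX: "z n \<in> X" for n
    unfolding z_def using X x y t[of n] by (intro convexD) auto
  have zlim: "z \<longlonglongrightarrow> y"
  proof -
    have "t \<longlonglongrightarrow> 0" unfolding t_def
      using LIMSEQ_Suc[OF LIMSEQ_inverse_real_of_nat] by simp
    then have "(\<lambda>n. y - t n *\<^sub>R (y - x)) \<longlonglongrightarrow> y - 0 *\<^sub>R (y - x)" by (intro tendsto_intros)
    then show ?thesis by (simp add: zy[abs_def])
  qed
  \<comment> \<open>A bound for \<open>bregman h x (z n)\<close>: the first summand controls the
    difference of values through the gradient at \<open>x\<close>, the second the inner product
    through minimality.\<close>
  define C where "C = norm (gradient h x) * norm (y - x) + norm a * norm (y - x)"
  have bd: "norm (gradient h (z n)) \<le> (B + C) / e" for n
  proof -
    have zx: "z n - x = (1 - t n) *\<^sub>R (y - x)" by (simp add: z_def algebra_simps)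
    have nz: "norm (z n - x) \<le> norm (y - x)"
      unfolding zx using t[of n] by (simp add: mult_left_le_one_le)
    have "0 \<le> bregman h (z n) x" using bregman_nonneg x zi interior_subset by blast
    then have 1: "?H x - ?H (z n) \<le> - (gradient h x \<bullet> (z n - x))" by (simp add: bregman_def)
    have 2: "- (gradient h x \<bullet> (z n - x)) \<le> norm (gradient h x) * norm (y - x)"
      using norm_cauchy_schwarz[of "- gradient h x" "z n - x"] nz
      by (smt (verit) inner_minus_left mult_left_mono norm_ge_zero norm_minus_cancel)
    have "0 \<le> bregman h y (z n)" using bregman_nonneg y zi by blast
    then have "?H (z n) - ?H y \<le> - (gradient h (z n) \<bullet> (y - z n))" by (simp add: bregman_def)
    also have "\<dots> = t n * (gradient h (z n) \<bullet> (x - y))"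
      by (simp add: zy inner_diff_right algebra_simps)
    finally have 3: "?H (z n) - ?H y \<le> t n * (gradient h (z n) \<bullet> (x - y))" .
    have "a \<bullet> (y - x) + ?H y \<le> a \<bullet> (z n - x) + ?H (z n)"
      using min zX zi interior_subset by blast
    then have "- (t n * (a \<bullet> (x - y))) \<le> ?H (z n) - ?H y"
      by (simp add: zy inner_diff_right algebra_simps)
    with 3 have "t n * (- (a \<bullet> (x - y))) \<le> t n * (gradient h (z n) \<bullet> (x - y))" by simp
    then have "- (a \<bullet> (x - y)) \<le> gradient h (z n) \<bullet> (x - y)"
      using t[of n] mult_le_cancel_left_pos by blast
    then have 4: "- (gradient h (z n) \<bullet> (x - y)) \<le> norm a * norm (y - x)"
      using norm_cauchy_schwarz[of a "x - y"] by (simp add: norm_minus_commute)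
    have "- (gradient h (z n) \<bullet> (x - z n)) = (1 - t n) * - (gradient h (z n) \<bullet> (x - y))"
      by (simp add: zy inner_diff_right algebra_simps)
    also have "\<dots> \<le> (1 - t n) * (norm a * norm (y - x))"
      using 4 t[of n] by (intro mult_left_mono) auto
    also have "\<dots> \<le> norm a * norm (y - x)"
      using t[of n] by (intro mult_left_le_one_le) auto
    finally have "bregman h x (z n) \<le> C"
      using 1 2 unfolding bregman_def C_def by linarith
    then have "e * norm (gradient h (z n)) \<le> B + C" using e(2)[OF zi[of n]] by linarith
    then show ?thesis using e(1) by (simp add: field_simps)
  qed
  show ?thesis by (rule limit_in_interior[OF zi zlim bd])
qed

text \<open>A closed \<open>h\<close> need not be continuous on its domain, so the extreme value
  theorem is applied on the epigraph, where the objective becomes a continuous affine function. A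
  sublevel set there is closed since \<open>h\<close> is closed, and bounded by the quadratic
  growth.\<close>

lemma minimizer_exists:
  assumes X: "closed X" and x: "x \<in> X \<inter> interior (edom h)" and q: "q > 0"
    and coercive: "\<And>z. z \<in> X \<inter> edom h \<Longrightarrow> q * (norm (z - x))\<^sup>2 \<le> bregman h z x"
  obtains y where "y \<in> X \<inter> edom h"
    "\<And>z. z \<in> X \<inter> edom h \<Longrightarrow>
      a \<bullet> (y - x) + real_of_ereal (h y) \<le> a \<bullet> (z - x) + real_of_ereal (h z)"
proof -
  let ?H = "\<lambda>z. real_of_ereal (h z)"
  \<comment> \<open>The level \<open>?H x\<close> is the objective at \<open>x\<close>, which puts
    \<open>(x, ?H x)\<close> into the set.\<close>
  define S where "S = {p \<in> eepigraph h. fst p \<in> X \<and> a \<bullet> (fst p - x) + snd p \<le> ?H x}"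
  have xD: "x \<in> edom h" using x interior_subset by blast
  have dom: "fst p \<in> edom h" "?H (fst p) \<le> snd p" if "p \<in> eepigraph h" for p
  proof -
    have le: "h (fst p) \<le> ereal (snd p)" using that by (auto simp: eepigraph_def)
    then show d: "fst p \<in> edom h" by (auto simp: edom_def intro: le_less_trans)
    show "?H (fst p) \<le> snd p" using le edom_ereal[OF legendre_proper d] by (metis ereal_less_eq(3))
  qed
  have "S = eepigraph h \<inter> (X \<times> UNIV) \<inter> {p. a \<bullet> (fst p - x) + snd p \<le> ?H x}"
    by (auto simp: S_def)
  moreover have "closed {p::'a \<times> real. a \<bullet> (fst p - x) + snd p \<le> ?H x}"
    by (intro closed_Collect_le continuous_intros)
  ultimately have "closed S"
    using legendre_closed X by (simp add: closed_Int closed_Times)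
  moreover have "bounded S"
  proof -
    define G where "G = norm (gradient h x)"
    \<comment> \<open>On \<open>S\<close> the distance n to \<open>x\<close> satisfies
      \<open>q * n * n \<le> (G + norm a) * n\<close>, whence this radius.\<close>
    define L where "L = (G + norm a) / q"
    have "p \<in> cball x L \<times> {?H x - G * L .. ?H x + norm a * L}" if "p \<in> S" for p
    proof -
      define n where "n = norm (fst p - x)"
      have p: "p \<in> eepigraph h" "fst p \<in> X" "a \<bullet> (fst p - x) + snd p \<le> ?H x"
        using that by (auto simp: S_def)
      have ge: "?H x + gradient h x \<bullet> (fst p - x) + q * n\<^sup>2 \<le> snd p"
        using coercive[of "fst p"] dom[OF p(1)] p(2) by (simp add: bregman_def n_def)
      have g: "- (G * n) \<le> gradient h x \<bullet> (fst p - x)" and a: "- (norm a * n) \<le> a \<bullet> (fst p - x)"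
        using Cauchy_Schwarz_ineq2[of "gradient h x" "fst p - x"]
          Cauchy_Schwarz_ineq2[of a "fst p - x"] by (auto simp: n_def G_def)
      have "q * n * n \<le> (G + norm a) * n"
        using ge g a p(3) by (simp add: power2_eq_square algebra_simps)
      moreover have "n \<ge> 0" "G + norm a \<ge> 0" by (auto simp: n_def G_def)
      ultimately have "q * n \<le> G + norm a"
        by (cases "n = 0") (auto simp: mult_le_cancel_right)
      then have nL: "n \<le> L" using q by (simp add: L_def field_simps)
      moreover have "G * n \<le> G * L" "norm a * n \<le> norm a * L" 
        using nL by (auto simp: G_def intro: mult_left_mono)
      moreover have "q * n\<^sup>2 \<ge> 0" using q by simp
      ultimately show ?thesis
        using ge g a p(3) by (cases p) (auto simp: n_def dist_norm norm_minus_commute)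
    qed
    then have "S \<subseteq> cball x L \<times> {?H x - G * L .. ?H x + norm a * L}" by blast
    then show ?thesis
      using bounded_subset bounded_Times bounded_cball bounded_closed_interval by metis
  qed
  ultimately have "compact S" by (simp add: compact_eq_bounded_closed)
  moreover have "(x, ?H x) \<in> S"
    using x edom_ereal[OF legendre_proper xD] by (simp add: S_def eepigraph_def)
  moreover have "continuous_on S (\<lambda>p. a \<bullet> (fst p - x) + snd p)" by (intro continuous_intros)
  ultimately obtain p where p: "p \<in> S"
    and min: "\<And>r. r \<in> S \<Longrightarrow> a \<bullet> (fst p - x) + snd p \<le> a \<bullet> (fst r - x) + snd r"
    using continuous_attains_inf[of S] by blast
  show ?thesis
  proof (rule that)
    show "fst p \<in> X \<inter> edom h" using p dom by (auto simp: S_def)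
    fix z assume z: "z \<in> X \<inter> edom h"
    have "a \<bullet> (fst p - x) + ?H (fst p) \<le> a \<bullet> (fst p - x) + snd p"
      using dom(2) p by (auto simp: S_def)
    also have "\<dots> \<le> a \<bullet> (z - x) + ?H z"
    proof (cases "a \<bullet> (z - x) + ?H z \<le> ?H x")
      case True
      then have "(z, ?H z) \<in> S"
        using z edom_ereal[OF legendre_proper, of z] by (simp add: S_def eepigraph_def)
      then show ?thesis using min by fastforce
    next
      case False
      then show ?thesis using p by (auto simp: S_def)
    qed
    finally show "a \<bullet> (fst p - x) + ?H (fst p) \<le> a \<bullet> (z - x) + ?H z" .
  qed
qed

text \<open>First-order optimality: the one-sided derivative of the objective at \<open>y\<close>
  towards any feasible \<open>w\<close> is nonnegative.\<close>

lemma minimizer_variational: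
  assumes X: "convex X" and y: "y \<in> X \<inter> interior (edom h)" and w: "w \<in> X \<inter> edom h"
    and min: "\<And>z. z \<in> X \<inter> edom h \<Longrightarrow>
      a \<bullet> (y - x) + real_of_ereal (h y) \<le> a \<bullet> (z - x) + real_of_ereal (h z)"
  shows "0 \<le> (a + gradient h y) \<bullet> (w - y)"
proof -
  let ?H = "\<lambda>z. real_of_ereal (h z)"
  have "eventually (\<lambda>t::real. t \<in> {0<..<1}) (at_right 0)"
    using eventually_at_right_real[of 0 1] by simp
  then have "eventually (\<lambda>t. - (a \<bullet> (w - y)) \<le> (?H (y + t *\<^sub>R (w - y)) - ?H y) / t) (at_right 0)"
  proof eventually_elim
    case (elim t)
    have eq: "y + t *\<^sub>R (w - y) = (1 - t) *\<^sub>R y + t *\<^sub>R w" by (simp add: algebra_simps)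
    have "y + t *\<^sub>R (w - y) \<in> X \<inter> edom h"
      unfolding eq using elim y w interior_subset X legendre_convex_edom
      by (intro IntI convexD) auto
    from min[OF this] show ?case using elim by (simp add: field_simps inner_diff_right inner_add_right)
  qed
  then have "- (a \<bullet> (w - y)) \<le> gradient h y \<bullet> (w - y)"
    using y by (intro tendsto_lowerbound[OF directional_derivative[OF gradient_GDERIV]]) auto
  then show ?thesis by (simp add: inner_add_left)
qed

text \<open>Bounded divergence from \<open>w\<close> gives bounded gradients, which
  \<open>limit_in_interior\<close> turns into interior limits. This later supplies the compact set
  on which the subgradients are bounded.\<close>

lemma closure_bregman_bounded:
  assumes w: "w \<in> interior (edom h)" and z: "\<And>n. z n \<in> interior (edom h)"
    and bd: "\<And>n. bregman h w (z n) \<le> C"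
  shows "closure (range z) \<subseteq> interior (edom h)"
proof
  fix y assume "y \<in> closure (range z)"
  then obtain u where u: "\<And>n. u n \<in> range z" "u \<longlonglongrightarrow> y"
    unfolding closure_sequential by blast
  obtain e B where e: "e > 0"
    "\<And>y. y \<in> interior (edom h) \<Longrightarrow> e * norm (gradient h y) \<le> B + bregman h w y"
    using gradient_le_bregman w by blast
  have "norm (gradient h (u n)) \<le> (B + C) / e" for n
  proof -
    obtain m where m: "u n = z m" using u(1) by blast
    have "e * norm (gradient h (u n)) \<le> B + C" using e(2)[OF z[of m]] bd[of m] m by simp
    then show ?thesis using e(1) by (simp add: field_simps)
  qed
  moreover have "u n \<in> interior (edom h)" for n using u(1)[of n] z by auto
  ultimately show "y \<in> interior (edom h)" using u(2) limit_in_interior by blast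
qed

end

section \<open>Norms and dual norms\<close>

lemma is_norm_zero: "is_norm N \<Longrightarrow> N 0 = 0"
  and is_norm_scaleR: "is_norm N \<Longrightarrow> N (a *\<^sub>R x) = \<bar>a\<bar> * N x"
  by (auto simp: is_norm_def)

lemma is_norm_continuous:
  fixes N :: "'a::euclidean_space \<Rightarrow> real"
  assumes "is_norm N"
  shows "continuous_on UNIV N"
proof (rule convex_on_continuous)
  show "convex_on UNIV N"
  proof (rule convex_onI)
    fix t :: real and x y :: 'a assume "0 < t" "t < 1"
    then show "N ((1 - t) *\<^sub>R x + t *\<^sub>R y) \<le> (1 - t) * N x + t * N y"
      using assms unfolding is_norm_def by (smt (verit))
  qed simp
qed simp

text \<open>The constant is the minimum of \<open>N\<close> on the Euclidean unit sphere, positive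
  because \<open>N\<close> vanishes only at 0; homogeneity does the rest.\<close>

lemma is_norm_lower:
  fixes N :: "'a::euclidean_space \<Rightarrow> real"
  assumes N: "is_norm N"
  obtains b where "b > 0" "\<And>x. b * norm x \<le> N x"
proof -
  obtain s :: 'a where s: "s \<in> sphere 0 1" "\<And>z. z \<in> sphere 0 1 \<Longrightarrow> N s \<le> N z"
    using continuous_attains_inf[of "sphere 0 1" N] continuous_on_subset[OF is_norm_continuous[OF N]]
    by auto
  show ?thesis
  proof (rule that)
    have "s \<noteq> 0" using s(1) by auto
    then show "0 < N s" using N unfolding is_norm_def by (metis less_eq_real_def)
    fix x
    show "N s * norm x \<le> N x"
    proof (cases "x = 0")
      case False
      have "N s \<le> N (x /\<^sub>R norm x)" using False by (intro s(2)) simp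
      also have "\<dots> = N x / norm x"
        using N False unfolding is_norm_def by (simp add: field_simps)
      finally show ?thesis using False by (simp add: field_simps)
    qed (simp add: is_norm_zero[OF N])
  qed
qed

text \<open>Shows that the set in \<open>dual_norm\<close> is bounded above, so that its real
  \<open>Sup\<close> is a genuine supremum.\<close>

lemma dual_norm_bdd:
  fixes N :: "'a::euclidean_space \<Rightarrow> real"
  assumes b: "b > 0" "\<And>x. b * norm x \<le> N x" and x: "N x \<le> 1"
  shows "z \<bullet> x \<le> norm z / b"
proof -
  have "norm x \<le> 1 / b" using b(1) b(2)[of x] x by (simp add: field_simps)
  then have "norm z * norm x \<le> norm z * (1 / b)" by (intro mult_left_mono) auto
  then show ?thesis using norm_cauchy_schwarz[of z x] by simp
qed

lemma dual_norm_le: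
  fixes N :: "'a::euclidean_space \<Rightarrow> real"
  assumes N: "is_norm N" and b: "b > 0" "\<And>x. b * norm x \<le> N x"
  shows "dual_norm N z \<le> norm z / b"
proof -
  have "N 0 \<le> 1" by (simp add: is_norm_zero[OF N])
  then show ?thesis unfolding dual_norm_def
    using dual_norm_bdd[OF b] by (intro cSup_least) auto
qed

lemma dual_norm_ineq:
  fixes N :: "'a::euclidean_space \<Rightarrow> real"
  assumes N: "is_norm N"
  shows "z \<bullet> x \<le> dual_norm N z * N x"
proof (cases "x = 0")
  case True
  then show ?thesis by (simp add: is_norm_zero[OF N])
next
  case False
  obtain b where b: "b > 0" "\<And>x. b * norm x \<le> N x" using is_norm_lower[OF N] by blast
  have pos: "N x > 0" using N False unfolding is_norm_def by (metis less_eq_real_def)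
  then have "N (x /\<^sub>R N x) = 1" by (simp add: is_norm_scaleR[OF N])
  then have "z \<bullet> (x /\<^sub>R N x) \<le> dual_norm N z"
    unfolding dual_norm_def using dual_norm_bdd[OF b]
    by (intro cSup_upper bdd_aboveI[of _ "norm z / b"] CollectI exI[of _ "x /\<^sub>R N x"]) auto
  then show ?thesis using pos by (simp add: field_simps)
qed

lemma dual_norm_pos:
  fixes N :: "'a::euclidean_space \<Rightarrow> real"
  assumes N: "is_norm N" and "z \<noteq> 0"
  shows "dual_norm N z > 0"
proof -
  have "0 < z \<bullet> z" using assms(2) by simp
  also have "\<dots> \<le> dual_norm N z * N z" by (rule dual_norm_ineq[OF N])
  finally show ?thesis using N unfolding is_norm_def by (metis not_less zero_less_mult_pos2 less_eq_real_def mult_zero_right)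
qed

section \<open>Stabilization of the gaps\<close>

text \<open>The best values decrease and are bounded below, so their drops eventually fall under
  \<delta>. A met target would force a drop of at least \<delta>; hence from some index on every
  target is missed and the gap contracts until it rests at \<delta>.\<close>

lemma eventually_gap_eq:
  fixes F \<Delta> :: "nat \<Rightarrow> real"
  defines "M \<equiv> \<lambda>k. Min (F ` {1..k})"
  assumes lower: "\<And>k. k \<ge> 1 \<Longrightarrow> L \<le> F k"
    and step: "\<And>k. k \<ge> 1 \<Longrightarrow>
      \<Delta> (Suc k) = (if F (Suc k) \<le> M k - \<Delta> k then \<gamma> * \<Delta> k else max (\<beta> * \<Delta> k) \<delta>)"
    and ge: "\<And>k. k \<ge> 1 \<Longrightarrow> \<delta> \<le> \<Delta> k"
    and "\<delta> > 0" "\<beta> < 1"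
  shows "\<exists>K\<ge>1. \<forall>k\<ge>K. \<Delta> k = \<delta>"
proof -
  have MS: "M (Suc k) = min (F (Suc k)) (M k)" if "k \<ge> 1" for k
  proof -
    have "{1..Suc k} = insert (Suc k) {1..k}" by auto
    then show ?thesis using that by (simp add: M_def)
  qed
  \<comment> \<open>The shift avoids \<open>M 0\<close>, the minimum of an empty set.\<close>
  have "decseq (\<lambda>k. M (Suc k))" by (rule decseq_SucI) (simp add: MS)
  moreover have "L \<le> M (Suc k)" for k unfolding M_def using lower by (auto intro!: Min.boundedI)
  ultimately obtain l where l: "(\<lambda>k. M (Suc k)) \<longlonglongrightarrow> l" using decseq_convergent by blast
  have "(\<lambda>k. M (Suc k) - M (Suc (Suc k))) \<longlonglongrightarrow> l - l"
    by (rule tendsto_diff[OF l LIMSEQ_Suc[OF l]])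
  then have "eventually (\<lambda>k. M (Suc k) - M (Suc (Suc k)) < \<delta>) sequentially"
    using \<open>\<delta> > 0\<close> by (auto dest: order_tendstoD(2))
  then obtain K where K: "\<And>k. k \<ge> K \<Longrightarrow> M (Suc k) - M (Suc (Suc k)) < \<delta>"
    by (auto simp: eventually_sequentially)
  have fail: "\<Delta> (Suc k) = max (\<beta> * \<Delta> k) \<delta>" if "k \<ge> Suc K" for k
  proof -
    define j where "j = k - 1"
    have j: "k = Suc j" "j \<ge> K" using \<open>k \<ge> Suc K\<close> by (auto simp: j_def)
    have "\<not> F (Suc k) \<le> M k - \<Delta> k"
      using K[OF j(2)] MS[of k] ge[of k] j by auto
    then show ?thesis using step[of k] that by simp
  qed
  \<comment> \<open>\<beta> may be negative, even below -1; its nonnegative part has powers tending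
    to 0.\<close>
  define b where "b = max \<beta> 0"
  have le: "\<Delta> (Suc K + m) \<le> max (b ^ m * \<Delta> (Suc K)) \<delta>" for m
  proof (induction m)
    case (Suc m)
    have b: "0 \<le> b" "b < 1" "\<beta> \<le> b" using \<open>\<beta> < 1\<close> by (auto simp: b_def)
    have "\<Delta> (Suc K + Suc m) = max (\<beta> * \<Delta> (Suc K + m)) \<delta>" using fail[of "Suc K + m"] by simp
    also have "\<dots> \<le> max (b * \<Delta> (Suc K + m)) \<delta>"
      using b(3) ge[of "Suc K + m"] \<open>\<delta> > 0\<close> by (intro max.mono mult_right_mono) auto
    also have "\<dots> \<le> max (b * max (b ^ m * \<Delta> (Suc K)) \<delta>) \<delta>"
      using b Suc by (intro max.mono mult_left_mono) auto
    also have "\<dots> \<le> max (b ^ Suc m * \<Delta> (Suc K)) \<delta>"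
    proof -
      have "b * \<delta> \<le> \<delta>" using b \<open>\<delta> > 0\<close> by (simp add: mult_left_le_one_le)
      then show ?thesis by (auto simp: max_def mult.assoc)
    qed
    finally show ?case .
  qed simp
  have "(\<lambda>m. b ^ m * \<Delta> (Suc K)) \<longlonglongrightarrow> 0 * \<Delta> (Suc K)"
    using \<open>\<beta> < 1\<close> by (intro tendsto_intros LIMSEQ_realpow_zero) (auto simp: b_def)
  then have "eventually (\<lambda>m. b ^ m * \<Delta> (Suc K) < \<delta>) sequentially"
    using \<open>\<delta> > 0\<close> by (auto dest: order_tendstoD(2))
  then obtain m0 where m0: "\<And>m. m \<ge> m0 \<Longrightarrow> b ^ m * \<Delta> (Suc K) < \<delta>"
    by (auto simp: eventually_sequentially)
  have "\<Delta> k = \<delta>" if "k \<ge> Suc K + m0" for k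
  proof -
    define m where "m = k - Suc K"
    have m: "k = Suc K + m" "m \<ge> m0" using \<open>k \<ge> Suc K + m0\<close> by (auto simp: m_def)
    then show ?thesis using le[of m] m0[of m] ge[of k] by auto
  qed
  then show ?thesis by (intro exI[of _ "Suc K + m0"]) auto
qed

section \<open>Existence and descent of a mirror step\<close>

text \<open>Strong convexity is assumed only between interior points, while \<open>z\<close> may lie
  on the boundary. The midpoint of \<open>z\<close> and \<open>x\<close> is interior; the assumption
  there and convexity of \<open>h\<close> give the bound with half the constant.\<close>

lemma bregman_lower_norm:
  fixes h :: "'a::euclidean_space \<Rightarrow> ereal"
  assumes h: "Legendre_fun h" and X: "convex X" and N: "is_norm N"
    and sc: "\<And>y z. y \<in> X \<inter> interior (edom h) \<Longrightarrow> z \<in> X \<inter> interior (edom h) \<Longrightarrow>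
      1 / 2 * (N (z - y))\<^sup>2 \<le> bregman h y z"
    and x: "x \<in> X \<inter> interior (edom h)" and z: "z \<in> X \<inter> edom h"
  shows "1 / 4 * (N (z - x))\<^sup>2 \<le> bregman h z x"
proof -
  let ?H = "\<lambda>z. real_of_ereal (h z)"
  define m where "m = z - (1/2) *\<^sub>R (z - x)"
  have m: "m = (1 - 1/2) *\<^sub>R z + (1/2) *\<^sub>R x"
    by (simp add: m_def algebra_simps flip: scaleR_add_left)
  have "m \<in> interior (edom h)"
    unfolding m_def using x z
    by (intro mem_interior_convex_shrink legendre_convex_edom[OF h]) auto
  moreover have "m \<in> X" unfolding m using x z by (intro convexD X) auto
  ultimately have "1 / 2 * (N (x - m))\<^sup>2 \<le> bregman h m x" using x by (intro sc) auto
  moreover have "x - m = (- 1/2) *\<^sub>R (z - x)" by (simp add: m_def algebra_simps flip: scaleR_add_left)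
  then have "N (x - m) = 1/2 * N (z - x)" by (simp add: is_norm_scaleR[OF N] del: scaleR_minus_left)
  moreover have "?H m \<le> (1 - 1/2) * ?H z + 1/2 * ?H x"
    unfolding m using x z interior_subset
    by (intro convex_fun_ineq(2) legendre_proper[OF h] legendre_convex[OF h]) auto
  moreover have "m - x = (1/2) *\<^sub>R (z - x)" by (simp add: m_def algebra_simps flip: scaleR_add_left)
  ultimately show ?thesis by (simp add: bregman_def power_divide)
qed

text \<open>Up to the factor \<eta> and an additive constant, the objective is \<open>h\<close> plus
  the linear form of \<open>\<eta> *\<^sub>R v - gradient h x\<close>, so
  \<open>minimizer_exists\<close> applies with the growth from
  \<open>bregman_lower_norm\<close>.\<close>

lemma mirror_step_exists:
  fixes h :: "'a::euclidean_space \<Rightarrow> ereal"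
  assumes h: "Legendre_fun h" and X: "closed X" "convex X" and N: "is_norm N"
    and sc: "\<And>y z. y \<in> X \<inter> interior (edom h) \<Longrightarrow> z \<in> X \<inter> interior (edom h) \<Longrightarrow>
      1 / 2 * (N (z - y))\<^sup>2 \<le> bregman h y z"
    and x: "x \<in> X \<inter> interior (edom h)" and \<eta>: "\<eta> > 0"
  shows "\<exists>y. mirror_step h X v x \<eta> y"
proof -
  obtain b where b: "b > 0" "\<And>x. b * norm x \<le> N x" using is_norm_lower[OF N] by blast
  have "b\<^sup>2 / 4 * (norm (z - x))\<^sup>2 \<le> bregman h z x" if "z \<in> X \<inter> edom h" for z
  proof -
    have "(b * norm (z - x))\<^sup>2 \<le> (N (z - x))\<^sup>2" using b by (intro power_mono) auto
    then show ?thesis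
      using bregman_lower_norm[OF h X(2) N sc x that] by (simp add: power_mult_distrib)
  qed
  moreover have "b\<^sup>2 / 4 > 0" using b by simp
  ultimately obtain y where y: "y \<in> X \<inter> edom h"
    "\<And>z. z \<in> X \<inter> edom h \<Longrightarrow> (\<eta> *\<^sub>R v - gradient h x) \<bullet> (y - x) + real_of_ereal (h y)
      \<le> (\<eta> *\<^sub>R v - gradient h x) \<bullet> (z - x) + real_of_ereal (h z)"
    using minimizer_exists[OF h X(1) x] by metis
  have "x \<in> X" "x \<in> edom h" using x interior_subset by auto
  then show ?thesis
    using y mirror_step_iff[OF legendre_proper[OF h] _ _ \<eta>, of x X v]
    by (auto simp: bregman_def inner_diff_left algebra_simps intro!: exI[of _ y])
qed

text \<open>The variational inequality at \<open>y\<close> yields the three-point inequality with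
  the error term \<open>\<eta> * (v \<bullet> (w - y))\<close>. Splitting it at \<open>x\<close>
  leaves \<open>\<eta> * (v \<bullet> (x - y))\<close>, which Young's inequality bounds by the
  squared dual norm and a half squared distance; \<open>bregman h y x\<close> absorbs the
  latter.\<close>

lemma mirror_step_descent:
  fixes h :: "'a::euclidean_space \<Rightarrow> ereal"
  assumes h: "Legendre_fun h" and X: "convex X" and N: "is_norm N"
    and sc: "\<And>y z. y \<in> X \<inter> interior (edom h) \<Longrightarrow> z \<in> X \<inter> interior (edom h) \<Longrightarrow>
      1 / 2 * (N (z - y))\<^sup>2 \<le> bregman h y z"
    and x: "x \<in> X \<inter> interior (edom h)" and \<eta>: "\<eta> > 0"
    and step: "mirror_step h X v x \<eta> y"
  shows "y \<in> X \<inter> interior (edom h)"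
    and "w \<in> X \<inter> edom h \<Longrightarrow>
      bregman h w y \<le> bregman h w x - \<eta> * (v \<bullet> (x - w)) + \<eta>\<^sup>2 * (dual_norm N v)\<^sup>2 / 2"
proof -
  define a where "a = \<eta> *\<^sub>R v - gradient h x"
  have xd: "x \<in> X" "x \<in> edom h" using x interior_subset by auto
  have y: "y \<in> X \<inter> edom h" and min: "\<And>z. z \<in> X \<inter> edom h \<Longrightarrow>
      a \<bullet> (y - x) + real_of_ereal (h y) \<le> a \<bullet> (z - x) + real_of_ereal (h z)"
    using step mirror_step_iff[OF legendre_proper[OF h] xd \<eta>, of v y]
    by (auto simp: bregman_def a_def inner_diff_left algebra_simps)
  show yi: "y \<in> X \<inter> interior (edom h)"
    using minimizer_in_interior[OF h X x y min] y by blast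
  assume w: "w \<in> X \<inter> edom h"
  have "0 \<le> (a + gradient h y) \<bullet> (w - y)"
    by (rule minimizer_variational[OF h X yi w min])
  then have "bregman h w y \<le> bregman h w x - bregman h y x + \<eta> * (v \<bullet> (w - y))"
    by (simp add: bregman_def a_def inner_diff_left inner_diff_right inner_add_left algebra_simps)
  also have "\<eta> * (v \<bullet> (w - y)) = - (\<eta> * (v \<bullet> (x - w))) + \<eta> * (v \<bullet> (x - y))"
    by (simp add: inner_diff_right algebra_simps)
  also have "\<eta> * (v \<bullet> (x - y)) \<le> \<eta> * (dual_norm N v * N (x - y))"
    using \<eta> dual_norm_ineq[OF N] by (intro mult_left_mono) auto
  also have "\<dots> \<le> \<eta>\<^sup>2 * (dual_norm N v)\<^sup>2 / 2 + 1 / 2 * (N (x - y))\<^sup>2"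
    using zero_le_power2[of "\<eta> * dual_norm N v - N (x - y)"]
    by (simp add: power2_diff power_mult_distrib)
  finally show "bregman h w y \<le> bregman h w x - \<eta> * (v \<bullet> (x - w)) + \<eta>\<^sup>2 * (dual_norm N v)\<^sup>2 / 2"
    using sc[OF yi x] by simp
qed

section \<open>Convergence of the algorithm\<close>

theorem theorem3p1:
  fixes f h :: "real ^ 'd \<Rightarrow> ereal"
    and X :: "(real ^ 'd) set"
    and N :: "real ^ 'd \<Rightarrow> real"
    and g :: "real ^ 'd \<Rightarrow> real ^ 'd"
    and T :: "real ^ 'd \<Rightarrow> real \<Rightarrow> real ^ 'd"
    and fstar :: ereal
    and \<delta> \<delta>\<^sub>1 \<beta> \<gamma> c :: real
    and x\<^sub>1 :: "real ^ 'd"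
    and x :: "nat \<Rightarrow> real ^ 'd"
    and fhat :: "nat \<Rightarrow> ereal"
    and \<eta> \<Delta> :: "nat \<Rightarrow> real"
  assumes f: "proper f" "closed_fun f" "convex_fun f"
    and X: "X \<noteq> {}" "closed X" "convex X"
    and fstar: "fstar = (INF y\<in>X. f y)"
    and h: "convex_fun h"
    and N: "is_norm N"
    and g: "\<And>y. y \<in> X \<inter> interior (edom h) \<Longrightarrow> g y \<in> subdifferential f y"
    \<comment> \<open>\<open>T\<close> is an arbitrary choice of solutions of the mirror descent problems; that a solution
        exists is not part of the assumption\<close>
    and T: "\<And>y s. y \<in> X \<inter> interior (edom h) \<Longrightarrow> s > 0 \<Longrightarrow>
              \<exists>z. mirror_step h X (g y) y s z \<Longrightarrow> mirror_step h X (g y) y s (T y s)"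
    and A1: "\<bar>fstar\<bar> \<noteq> \<infinity>"
    and A2: "Legendre_fun h" "X \<inter> edom f \<subseteq> closure (edom h)"
    and A3: "X \<inter> interior (edom h) \<subseteq> rel_interior (edom f)"
    and A4: "\<And>y z. y \<in> X \<inter> interior (edom h) \<Longrightarrow> z \<in> X \<inter> interior (edom h) \<Longrightarrow>
              Bregman h y z \<ge> ereal (1 / 2 * (N (z - y))\<^sup>2)"
    and A5: "\<And>K. compact K \<Longrightarrow> K \<subseteq> X \<inter> interior (edom h) \<Longrightarrow> bounded (g ` K)"
    and params: "\<delta>\<^sub>1 \<ge> \<delta>" "\<delta> > 0" "\<beta> < 1" "\<gamma> \<ge> 1" "c > 1 / 2"
    and init: "x\<^sub>1 \<in> X \<inter> interior (edom h)" "x 1 = x\<^sub>1" "\<Delta> 1 = \<delta>\<^sub>1"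
    and ii: "\<And>k. k \<in> generated g x \<Longrightarrow> g (x k) \<noteq> 0 \<Longrightarrow>
              fhat k = Min ((\<lambda>\<kappa>. f (x \<kappa>)) ` {1..k}) - ereal (\<Delta> k)"
    and iii: "\<And>k. k \<in> generated g x \<Longrightarrow> g (x k) \<noteq> 0 \<Longrightarrow>
              \<eta> k = real_of_ereal (f (x k) - fhat k) / (c * (dual_norm N (g (x k)))\<^sup>2)"
    and iv: "\<And>k. k \<in> generated g x \<Longrightarrow> g (x k) \<noteq> 0 \<Longrightarrow> x (Suc k) = T (x k) (\<eta> k)"
    and v: "\<And>k. k \<in> generated g x \<Longrightarrow> g (x k) \<noteq> 0 \<Longrightarrow>
              \<Delta> (Suc k) = (if f (x (Suc k)) \<le> fhat k then \<gamma> * \<Delta> k else max (\<beta> * \<Delta> k) \<delta>)"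
  shows "(INF k \<in> generated g x. f (x k)) \<le> fstar + ereal \<delta>"
proof (rule ccontr)
  assume "\<not> (INF k \<in> generated g x. f (x k)) \<le> fstar + ereal \<delta>"
  then have gap: "fstar + ereal \<delta> < (INF k \<in> generated g x. f (x k))" by simp
  define S where "S = X \<inter> interior (edom h)"
  define F where "F k = real_of_ereal (f (x k))" for k
  define M where "M k = Min (F ` {1..k})" for k
  define G where "G k = dual_norm N (g (x k))" for k
  obtain L where L: "fstar = ereal L" using A1 by (metis ereal_real')
  have ph: "proper h" using A2(1) by (rule legendre_proper)
  have Sd: "y \<in> X" "y \<in> edom h" "y \<in> interior (edom h)" if "y \<in> S" for y
    using that interior_subset by (auto simp: S_def)
  have sc: "1 / 2 * (N (z - y))\<^sup>2 \<le> bregman h y z" if "y \<in> S" "z \<in> S" for y z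
    using A4[of y z] Bregman_eq[OF ph Sd(2) Sd(2)] that by (simp add: S_def)
  have fS: "y \<in> edom f" if "y \<in> S" for y
    using that A3 rel_interior_subset unfolding S_def by blast
  have sub: "real_of_ereal (f y) + g y \<bullet> (z - y) \<le> real_of_ereal (f z)"
    if "y \<in> S" "z \<in> edom f" for y z
  proof -
    have "f y + ereal (g y \<bullet> (z - y)) \<le> f z"
      using g[of y] that(1) by (auto simp: subdifferential_def S_def)
    then show ?thesis
      using edom_ereal[OF f(1) fS[OF that(1)]] edom_ereal[OF f(1) that(2)]
      by (metis ereal_less_eq(3) plus_ereal.simps(1))
  qed
  \<comment> \<open>The invariant of the run; \<open>good k\<close> below adds what round k itself
    delivers, including the invariant for the next index.\<close>
  define Q where "Q k \<longleftrightarrow> k \<in> generated g x \<and> x k \<in> S \<and> \<delta> \<le> \<Delta> k" for k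
  have Q1: "Q 1" using init params by (auto simp: Q_def generated_def S_def)
  have above: "L + \<delta> < F k" if "Q k" for k
  proof -
    have "ereal (L + \<delta>) < f (x k)"
      using less_INF_D[OF gap] that by (auto simp: Q_def L)
    moreover have "f (x k) = ereal (F k)"
      using that edom_ereal[OF f(1) fS] by (auto simp: Q_def F_def)
    ultimately show ?thesis by simp
  qed
  \<comment> \<open>A zero subgradient would make \<open>x k\<close> a global minimizer, against
    \<open>above\<close>. Hence the run never terminates under the contrary assumption.\<close>
  have nz: "g (x k) \<noteq> 0" if "Q k" for k
  proof
    assume 0: "g (x k) = 0"
    have "f (x k) \<le> f y" for y
      using that g[of "x k"] 0 by (auto simp: Q_def S_def subdifferential_def)
    then have "f (x k) \<le> fstar" unfolding fstar by (intro INF_greatest)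
    moreover have "f (x k) = ereal (F k)"
      using that edom_ereal[OF f(1) fS] by (auto simp: Q_def F_def)
    ultimately show False using above[OF that] L params by simp
  qed
  define good where "good k \<longleftrightarrow> \<eta> k = (F k - M k + \<Delta> k) / (c * (G k)\<^sup>2) \<and> \<eta> k > 0 \<and> G k > 0 \<and>
      mirror_step h X (g (x k)) (x k) (\<eta> k) (x (Suc k)) \<and>
      \<Delta> (Suc k) = (if F (Suc k) \<le> M k - \<Delta> k then \<gamma> * \<Delta> k else max (\<beta> * \<Delta> k) \<delta>) \<and> Q (Suc k)" for k
  \<comment> \<open>All earlier indices are required because the target involves the minimum over
    them; this is why the induction for \<open>Q\<close> is a strong one.\<close>
  have step: "good k" if k: "k \<ge> 1" and Q: "\<And>j. 1 \<le> j \<Longrightarrow> j \<le> k \<Longrightarrow> Q j" for k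
  proof -
    have Qk: "Q k" using Q k by simp
    note gk = nz[OF Qk]
    have gen: "k \<in> generated g x" and xk: "x k \<in> S" and Dk: "\<delta> \<le> \<Delta> k"
      using Qk by (auto simp: Q_def)
    have fx: "f (x j) = ereal (F j)" if "Q j" for j
      using that edom_ereal[OF f(1) fS] by (auto simp: Q_def F_def)
    have "(\<lambda>\<kappa>. f (x \<kappa>)) ` {1..k} = ereal ` F ` {1..k}"
      using Q fx by (auto simp: image_image intro!: image_cong)
    moreover have "ereal (Min (F ` {1..k})) = Min (ereal ` F ` {1..k})"
      using k by (intro mono_Min_commute) (auto simp: mono_def)
    ultimately have fh: "fhat k = ereal (M k - \<Delta> k)"
      using ii[OF gen gk] unfolding M_def by (metis ereal_minus(1))
    have eta: "\<eta> k = (F k - M k + \<Delta> k) / (c * (G k)\<^sup>2)"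
      using iii[OF gen gk] fx[OF Qk] fh by (simp add: G_def algebra_simps)
    have G: "G k > 0" unfolding G_def by (rule dual_norm_pos[OF N gk])
    have "M k \<le> F k" unfolding M_def using k by (intro Min_le) auto
    then have pos: "\<eta> k > 0" unfolding eta using Dk G params by (intro divide_pos_pos) auto
    \<comment> \<open>\<open>T\<close> is only assumed to solve solvable problems, so solvability is
      supplied by \<open>mirror_step_exists\<close>.\<close>
    have ms: "mirror_step h X (g (x k)) (x k) (\<eta> k) (x (Suc k))"
      unfolding iv[OF gen gk] using xk
      by (intro T pos mirror_step_exists[OF A2(1) X(2,3) N sc[unfolded S_def]]) (auto simp: S_def)
    have xS: "x (Suc k) \<in> S"
      using mirror_step_descent(1)[OF A2(1) X(3) N sc[unfolded S_def] _ pos ms] xk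
      by (simp add: S_def)
    have genS: "Suc k \<in> generated g x"
      using gen gk by (auto simp: generated_def less_Suc_eq)
    have fxS: "f (x (Suc k)) = ereal (F (Suc k))"
      using edom_ereal[OF f(1) fS[OF xS]] by (simp add: F_def)
    have D: "\<Delta> (Suc k) = (if F (Suc k) \<le> M k - \<Delta> k then \<gamma> * \<Delta> k else max (\<beta> * \<Delta> k) \<delta>)"
      using v[OF gen gk] fh fxS by simp
    have "\<Delta> k \<le> \<gamma> * \<Delta> k" using params Dk by simp
    then have "\<delta> \<le> \<Delta> (Suc k)" using D Dk by auto
    then show ?thesis using eta pos G ms D xS genS by (simp add: good_def Q_def)
  qed
  have Q: "Q k" if "k \<ge> 1" for k
    using that
  proof (induction k rule: less_induct)
    case (less k)
    show ?case
    proof (cases "k = 1")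
      case False
      then obtain j where "k = Suc j" "j \<ge> 1" using less.prems by (cases k) auto
      then show ?thesis using step[of j] less.IH by (auto simp: good_def)
    qed (use Q1 in simp)
  qed
  have good: "good k" if "k \<ge> 1" for k using step Q that by blast
  have xS: "x k \<in> S" if "k \<ge> 1" for k using Q[OF that] by (simp add: Q_def)
  obtain K where K: "K \<ge> 1" "\<And>k. k \<ge> K \<Longrightarrow> \<Delta> k = \<delta>"
    using eventually_gap_eq[of L F \<Delta> \<gamma> \<beta> \<delta>] good Q above params
    unfolding good_def Q_def M_def by (smt (verit))
  \<comment> \<open>Density of the extended reals turns the strict gap below the infimum into a
    margin uniform in k.\<close>
  obtain r where r: "L + \<delta> < r" "\<And>k. k \<ge> 1 \<Longrightarrow> r \<le> F k"
  proof -
    obtain e where e: "ereal (L + \<delta>) < ereal e" "ereal e < (INF k \<in> generated g x. f (x k))"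
      using ereal_dense2[OF gap] L by auto
    have "e \<le> F k" if "k \<ge> 1" for k
    proof -
      have "ereal e < f (x k)"
        using less_INF_D[OF e(2)] Q[OF that] by (auto simp: Q_def)
      then show ?thesis
        using edom_ereal[OF f(1) fS[OF xS[OF that]]] by (simp add: F_def) (metis ereal_less(2) less_ereal.simps(1) less_imp_le)
    qed
    then show thesis using e(1) that by auto
  qed
  obtain w where w: "w \<in> S" "real_of_ereal (f w) < r - \<delta>"
  proof -
    have "(INF y\<in>X. f y) < ereal (r - \<delta>)" unfolding fstar[symmetric] L using r(1) by simp
    then obtain w0 where w0: "w0 \<in> X" "f w0 < ereal (r - \<delta>)" by (auto simp: INF_less_iff)
    have w0f: "w0 \<in> edom f" using w0(2) by (auto simp: edom_def intro: less_trans)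
    define s where "s = r - \<delta> - real_of_ereal (f w0)"
    define D where "D = F 1 - real_of_ereal (f w0)"
    \<comment> \<open>The near-optimal \<open>w0\<close> may lie on the boundary of
      \<open>edom h\<close>, so it is moved towards the interior point \<open>x 1\<close>. This
      weight makes \<open>t * \<bar>D\<bar>\<close> less than the slack \<open>s\<close>, and
      convexity keeps the value below \<open>r - \<delta>\<close>.\<close>
    define t where "t = s / (s + \<bar>D\<bar> + 1)"
    have s: "s > 0"
      using w0(2) edom_ereal[OF f(1) w0f] unfolding s_def by (metis diff_gt_0_iff_gt less_ereal.simps(1))
    then have t: "0 < t" "t \<le> 1" by (auto simp: t_def field_simps)
    have "s * \<bar>D\<bar> < s * (s + \<bar>D\<bar> + 1)" using s by (intro mult_strict_left_mono) auto
    then have tD: "t * \<bar>D\<bar> < s" using s by (simp add: t_def field_simps)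
    define w where "w = (1 - t) *\<^sub>R w0 + t *\<^sub>R x 1"
    have x1: "x 1 \<in> S" using xS by simp
    have "w0 - t *\<^sub>R (w0 - x 1) \<in> interior (edom h)"
      using Sd[OF x1] A2 w0(1) w0f t
      by (intro mem_interior_closure_convex_shrink legendre_convex_edom) auto
    moreover have "w0 - t *\<^sub>R (w0 - x 1) = w" by (simp add: w_def algebra_simps)
    moreover have "w \<in> X" unfolding w_def using w0 Sd[OF x1] t X by (intro convexD) auto
    ultimately have "w \<in> S" by (simp add: S_def)
    moreover have "real_of_ereal (f w) \<le> (1 - t) * real_of_ereal (f w0) + t * F 1"
      unfolding w_def F_def using t w0f fS[OF x1] f by (intro convex_fun_ineq(2)) auto
    then have "real_of_ereal (f w) \<le> real_of_ereal (f w0) + t * D"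
      by (simp add: D_def algebra_simps)
    moreover have "t * D \<le> t * \<bar>D\<bar>" using t by (intro mult_left_mono) auto
    ultimately show thesis using tD that unfolding s_def by fastforce
  qed
  define \<epsilon> where "\<epsilon> = r - \<delta> - real_of_ereal (f w)"
  have \<epsilon>: "\<epsilon> > 0" using w(2) by (simp add: \<epsilon>_def)
  define V where "V k = bregman h w (x k)" for k
  have V: "V (Suc k) \<le> V k - \<eta> k * \<epsilon>" "\<delta> / (c * (G k)\<^sup>2) \<le> \<eta> k" if "k \<ge> K" for k
  proof -
    have k: "k \<ge> 1" using that K(1) by simp
    \<comment> \<open>The numerator of the step size once the gap equals \<delta>: the excess of
      \<open>F k\<close> over its target.\<close>
    define p where "p = F k - M k + \<delta>"
    have gd: "\<eta> k = p / (c * (G k)\<^sup>2)" "\<eta> k > 0" "G k > 0"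
      "mirror_step h X (g (x k)) (x k) (\<eta> k) (x (Suc k))"
      using good[OF k] K(2)[OF that] by (auto simp: good_def p_def)
    have "M k \<le> F k" unfolding M_def using k by (intro Min_le) auto
    then have p: "\<delta> \<le> p" by (simp add: p_def)
    then show "\<delta> / (c * (G k)\<^sup>2) \<le> \<eta> k"
      unfolding gd(1) using params by (intro divide_right_mono) auto
    have "r \<le> M k" unfolding M_def using k r(2) by (intro Min.boundedI) auto
    then have "p + \<epsilon> \<le> F k - real_of_ereal (f w)" by (simp add: p_def \<epsilon>_def)
    also have "\<dots> \<le> g (x k) \<bullet> (x k - w)"
      using sub[OF xS[OF k] fS[OF w(1)]] by (simp add: F_def inner_diff_right)
    finally have 1: "\<eta> k * (p + \<epsilon>) \<le> \<eta> k * (g (x k) \<bullet> (x k - w))"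
      using gd(2) by (intro mult_left_mono) auto
    \<comment> \<open>The step size turns the quadratic error into
      \<open>\<eta> k * p / (2 * c)\<close>; since c > 1/2 this is at most
      \<open>\<eta> k * p\<close>, leaving the decrease
      \<open>\<eta> k * \<epsilon>\<close>.\<close>
    have "\<eta> k * (G k)\<^sup>2 = p / c" using gd(1,3) by (simp add: field_simps)
    then have "(\<eta> k)\<^sup>2 * (G k)\<^sup>2 / 2 = \<eta> k * (p / (2 * c))"
      by (simp add: power2_eq_square field_simps)
    also have "\<dots> \<le> \<eta> k * p"
      using gd(2) params p by (intro mult_left_mono) (auto simp: field_simps)
    finally have 2: "(\<eta> k)\<^sup>2 * (G k)\<^sup>2 / 2 \<le> \<eta> k * p" .
    have "V (Suc k) \<le> V k - \<eta> k * (g (x k) \<bullet> (x k - w)) + (\<eta> k)\<^sup>2 * (G k)\<^sup>2 / 2"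
      unfolding V_def G_def
    proof (rule mirror_step_descent(2)[OF A2(1) X(3) N sc[unfolded S_def] _ gd(2,4)])
      show "x k \<in> X \<inter> interior (edom h)" using xS[OF k] by (simp only: S_def)
      show "w \<in> X \<inter> edom h" using Sd[OF w(1)] by blast
    qed
    then show "V (Suc k) \<le> V k - \<eta> k * \<epsilon>" using 1 2 by (simp add: algebra_simps)
  qed
  have V0: "0 \<le> V k" if "k \<ge> 1" for k
    unfolding V_def using bregman_nonneg[OF A2(1)] Sd w(1) xS[OF that] by blast
  have VK: "V (K + n) \<le> V K" for n
  proof (induction n)
    case (Suc n)
    have "\<eta> (K + n) > 0" using good[of "K + n"] K(1) by (simp add: good_def)
    then have "\<eta> (K + n) * \<epsilon> > 0" using \<epsilon> by simp
    then show ?case using V(1)[of "K + n"] Suc by simp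
  qed simp
  obtain b where b: "b > 0" "\<And>y. b * norm y \<le> N y" using is_norm_lower[OF N] by blast
  define z where "z n = x (K + n)" for n
  have zS: "z n \<in> S" for n unfolding z_def using xS K(1) by simp
  obtain \<eta>\<^sub>0 where \<eta>\<^sub>0: "\<eta>\<^sub>0 > 0" "\<And>n. \<eta>\<^sub>0 \<le> \<eta> (K + n)"
  proof -
    have "closure (range z) \<subseteq> interior (edom h)"
      using closure_bregman_bounded[OF A2(1), of w z "V K"] Sd zS w(1) VK by (simp add: V_def z_def)
    moreover have "closure (range z) \<subseteq> X"
      using zS Sd X(2) by (intro closure_minimal) auto
    moreover have "norm (z n - w) \<le> sqrt (2 * V K) / b" for n
    proof -
      have "(b * norm (z n - w))\<^sup>2 \<le> (N (z n - w))\<^sup>2" using b by (intro power_mono) auto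
      also have "\<dots> \<le> 2 * V K" using sc[OF w(1) zS[of n]] VK[of n] by (simp add: V_def z_def)
      finally have "b * norm (z n - w) \<le> sqrt (2 * V K)" by (rule real_le_rsqrt)
      then show ?thesis using b by (simp add: field_simps)
    qed
    then have "range z \<subseteq> cball w (sqrt (2 * V K) / b)"
      by (auto simp: dist_norm norm_minus_commute)
    then have "bounded (range z)" by (rule bounded_subset[OF bounded_cball])
    ultimately have "bounded (g ` closure (range z))"
      by (intro A5) auto
    then obtain m where m: "\<And>y. y \<in> closure (range z) \<Longrightarrow> norm (g y) \<le> m"
      by (auto simp: bounded_iff)
    have gm: "norm (g (z n)) \<le> m" for n
      by (rule m[OF subsetD[OF closure_subset rangeI]])
    \<comment> \<open>Adding 1 keeps the denominator positive even for m = 0.\<close>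
    have "\<delta> / (c * (\<bar>m\<bar> / b + 1)\<^sup>2) \<le> \<eta> (K + n)" for n
    proof -
      have "G (K + n) \<le> norm (g (z n)) / b" unfolding G_def z_def by (rule dual_norm_le[OF N b])
      also have "\<dots> \<le> \<bar>m\<bar> / b + 1"
        using gm[of n] b(1) by (intro add_increasing2 divide_right_mono) auto
      finally have le: "G (K + n) \<le> \<bar>m\<bar> / b + 1" .
      have pos: "G (K + n) > 0" using good[of "K + n"] K(1) by (simp add: good_def)
      have "(G (K + n))\<^sup>2 \<le> (\<bar>m\<bar> / b + 1)\<^sup>2" using le pos by (intro power_mono) auto
      then have "\<delta> / (c * (\<bar>m\<bar> / b + 1)\<^sup>2) \<le> \<delta> / (c * (G (K + n))\<^sup>2)"
        using params pos by (intro divide_left_mono mult_left_mono mult_pos_pos) auto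
      also have "\<dots> \<le> \<eta> (K + n)" by (rule V(2)) simp
      finally show ?thesis .
    qed
    moreover have "\<bar>m\<bar> / b + 1 > 0" using b(1) by (simp add: add_nonneg_pos)
    then have "\<delta> / (c * (\<bar>m\<bar> / b + 1)\<^sup>2) > 0" using params by simp
    ultimately show thesis by (rule that[rotated])
  qed
  have "V (K + n) \<le> V K - real n * (\<eta>\<^sub>0 * \<epsilon>)" for n
  proof (induction n)
    case (Suc n)
    have "\<eta>\<^sub>0 * \<epsilon> \<le> \<eta> (K + n) * \<epsilon>" using \<eta>\<^sub>0(2) \<epsilon> by (intro mult_right_mono) auto
    then show ?case using V(1)[of "K + n"] Suc by (simp add: algebra_simps)
  qed simp
  moreover obtain n where "V K < real n * (\<eta>\<^sub>0 * \<epsilon>)"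
    using reals_Archimedean3[of "\<eta>\<^sub>0 * \<epsilon>"] \<eta>\<^sub>0(1) \<epsilon> by auto
  ultimately show False using V0[of "K + n"] K(1) by (smt (verit) trans_le_add1)
qed

end
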